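(* Let $q\ge 5$ be a prime power, and index the coordinates of $V=\mathbb F_q^{q+1}$ by $\mathbb F_q\cup\{\infty\}$. Let $L$ be the simplex line whose points are represented by the vectors \[ A(t)=\bigl((t-a)_{a\in\mathbb F_q},\,1\bigr)\quad (t\in\mathbb F_q),\qquad A(\infty)=(1,\dots,1,0), \] where the last entry is the coordinate at position $\infty$. Let $\xi$ be a generator of $\mathbb F_q^\times$, let $S\subseteq \mathbb F_q\cup\{\infty\}$ be a set of exactly three coordinate positions, and let $D=\operatorname{diag}(d_k)_{k\in\mathbb F_q\cup\{\infty\}}$ with $d_k=\xi$ if $k\in S$ and $d_k=1$ if $k\notin S$. Let $M=D(L)$, which is again a simplex line. Then $L$ and $M$ are at distance $3$ in $\Gamma^{s}(2,q)$. Consequently, $\operatorname{diam}\Gamma^{s}(2,q)=3$.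
   Context: Let $V=\mathbb F_q^{q+1}$. A two-dimensional $q$-ary simplex code is a two-dimensional linear subspace of $V$ in which every non-zero vector has exactly one zero coordinate (Hamming weight $q$). A simplex line is the line of the projective space $\mathbb P(V)$ corresponding to such a subspace. The graph $\Gamma^{s}(2,q)$ has the simplex lines as vertices; two distinct vertices are adjacent if and only if the lines meet in a point of $\mathbb P(V)$ (equivalently, the two subspaces have one-dimensional intersection). Distance means path distance in this graph and $\operatorname{diam}$ is the maximum distance between two vertices. *)

theory Defs
  imports "HOL-Analysis.Analysis" "Graph_Theory.Graph_Theory"
begin

text \<open>
  The field with \<open>q\<close> elements is a finite field type \<open>'a\<close>, with \<open>q = CARD('a)\<close>. The coordinate
  positions are the elements of \<open>'a option\<close>: \<open>Some a\<close> is the position of the field element \<open>a\<close>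
  and \<open>None\<close> is the position at infinity. Since \<open>CARD('a option) = q + 1\<close>, the ambient space
  is \<open>'a ^ 'a option\<close>.
\<close>

definition simplex_code :: "('a::{field,finite} ^ 'a option) set \<Rightarrow> bool" where
  "simplex_code W \<longleftrightarrow> vec.subspace W \<and> vec.dim W = 2 \<and>
     (\<forall>x\<in>W. x \<noteq> 0 \<longrightarrow> card {k. x $ k = 0} = 1)"

text \<open>Points of the projective space are one-dimensional subspaces; a line is the set of its points.\<close>

definition proj_point :: "('a::field ^ 'n::finite) set \<Rightarrow> bool" where
  "proj_point P \<longleftrightarrow> vec.subspace P \<and> vec.dim P = 1"

definition proj_points_of :: "('a::field ^ 'n::finite) set \<Rightarrow> ('a ^ 'n) set set" where
  "proj_points_of W = {P. proj_point P \<and> P \<subseteq> W}"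

definition simplex_lines :: "('a::{field,finite} ^ 'a option) set set set" where
  "simplex_lines = {proj_points_of W | W. simplex_code W}"

definition simplex_graph :: "('a::{field,finite} ^ 'a option) set set pair_pre_digraph" where
  "simplex_graph = \<lparr> pverts = simplex_lines,
     parcs = {(l, m). l \<in> simplex_lines \<and> m \<in> simplex_lines \<and> l \<noteq> m \<and> (\<exists>P. l \<inter> m = {P})} \<rparr>"

lemma graph_simplex_graph: "graph (with_proj simplex_graph)"
proof
  fix e1 e2 assume "arc_to_ends (with_proj simplex_graph) e1 = arc_to_ends (with_proj simplex_graph) e2"
  then show "e1 = e2" by (simp add: arc_to_ends_def prod_eq_iff)
qed (auto simp: simplex_graph_def symmetric_def sym_def Int_commute)

text \<open>Path distance: the least cost of a walk when every arc has weight 1 (infinite if there is none).\<close>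

definition graph_dist :: "('v, 'e) pre_digraph \<Rightarrow> 'v \<Rightarrow> 'v \<Rightarrow> ereal" where
  "graph_dist G u v = wf_digraph.\<mu> G (\<lambda>_. 1) u v"

definition graph_diam :: "('v, 'e) pre_digraph \<Rightarrow> ereal" where
  "graph_diam G = (SUP u\<in>verts G. SUP v\<in>verts G. graph_dist G u v)"

fun A_vec :: "'a::{field,finite} option \<Rightarrow> 'a ^ 'a option" where
  "A_vec (Some t) = (\<chi> k. case k of Some a \<Rightarrow> t - a | None \<Rightarrow> 1)"
| "A_vec None = (\<chi> k. case k of Some a \<Rightarrow> 1 | None \<Rightarrow> 0)"

definition line_L :: "('a::{field,finite} ^ 'a option) set set" where
  "line_L = {vec.span {A_vec t} | t. True}"

definition diag_mat :: "('n::finite \<Rightarrow> 'a::field) \<Rightarrow> 'a ^ 'n ^ 'n" where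
  "diag_mat d = (\<chi> i j. if i = j then d i else 0)"

text \<open>The action of a matrix on a set of projective points.\<close>

definition matrix_image :: "'a::field ^ 'n ^ 'n \<Rightarrow> ('a ^ 'n::finite) set set \<Rightarrow> ('a ^ 'n) set set" where
  "matrix_image D l = (\<lambda>P. (\<lambda>x. D *v x) ` P) ` l"

definition line_M :: "'a::{field,finite} \<Rightarrow> 'a option set \<Rightarrow> ('a ^ 'a option) set set" where
  "line_M \<xi> S = matrix_image (diag_mat (\<lambda>k. if k \<in> S then \<xi> else 1)) line_L"

definition generates_units :: "'a::field \<Rightarrow> bool" where
  "generates_units \<xi> \<longleftrightarrow> \<xi> \<noteq> 0 \<and> {x. x \<noteq> 0} = range (\<lambda>k::int. \<xi> powi k)"

end

theory Submission
  imports Defs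
begin

text \<open>
  Two vectors with their single zeros at different positions \<open>i\<close> and \<open>j\<close> span a simplex code if
  and only if their coordinatewise ratio on the other \<open>q - 1\<close> positions runs once through
  the non-zero scalars (\<open>simplex_code_ratio_bij\<close>, \<open>simplex_code_spanI\<close>). Both halves of the theorem
  follow from this criterion.

  \<^emph>\<open>Lower bound.\<close> A walk of length at most two from \<open>L\<close> to \<open>M = D(L)\<close> yields a simplex code
  containing some \<open>x\<close> on \<open>L\<close> and some \<open>D y\<close> with \<open>y\<close> on \<open>L\<close>. If the zeros of \<open>x\<close> and \<open>y\<close> lie at
  different positions \<open>i\<close> and \<open>j\<close>, then both the entries of \<open>y / x\<close> and those of \<open>D y / x\<close> off these
  positions multiply to the product of all non-zero scalars, so the product of the \<open>d\<^sub>k\<close> with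
  \<open>k \<noteq> i, j\<close> is 1. But this product is \<open>\<xi>\<close>, \<open>\<xi>\<^sup>2\<close> or \<open>\<xi>\<^sup>3\<close>, and none of these is 1 because \<open>\<xi>\<close>
  has order \<open>q - 1 \<ge> 4\<close>. If the zeros coincide, then \<open>x\<close> is proportional both to \<open>y\<close> and to \<open>D y\<close>,
  so \<open>d\<close> is constant off one position, which is impossible since both \<open>S\<close> and its complement
  have at least two elements.

  \<^emph>\<open>Upper bound.\<close> For arbitrary simplex codes \<open>W\<close> and \<open>W'\<close> take \<open>x\<close> in \<open>W\<close> and \<open>y\<close> in \<open>W'\<close> with zeros
  at different positions, and look for a vector \<open>p\<close>, with its zero at a third position, that spans
  a simplex code with \<open>x\<close> and another one with \<open>y\<close>. On the remaining \<open>q - 2\<close> positions write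
  \<open>p = u x\<close>; both \<open>u\<close> and \<open>u x / y\<close> must take distinct values there. Such \<open>u\<close> exists for
  every choice of \<open>x / y\<close>: this is Hall's theorem on abelian groups (\<open>hall_multipliers\<close>). The two
  missing coordinates of \<open>p\<close> are then filled with the non-zero values that were left out.
\<close>

section \<open>Hall's theorem for the units of a finite field\<close>

text \<open>
  M. Hall (1952) showed that in a finite abelian group of order \<open>n\<close> every sequence of \<open>n\<close> elements
  with trivial product is the termwise quotient of two orderings of the group. The equivalent
  form for \<open>n - 1\<close> arbitrary elements is proved here for the multiplicative group of a field,
  one position at a time.

  Let the position \<open>i\<close> own the value \<open>a i\<close> and the product \<open>c i = a i * z i\<close>. Replacing
  \<open>(a i, c i)\<close> by \<open>(C / c i, C / a i)\<close> preserves the quotient \<open>z i\<close>. This reflection takes away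
  the product \<open>C / a i\<close> from its owner, which has to be reflected as well. The set
  below collects the positions forced in this way once \<open>C / g\<close> has been taken away from its owner.
\<close>

inductive_set exchange_chain for K :: "'i set" and a c :: "'i \<Rightarrow> 'a::field" and C g :: 'a where
  start: "i \<in> K \<Longrightarrow> c i = C / g \<Longrightarrow> i \<in> exchange_chain K a c C g"
| step: "i \<in> exchange_chain K a c C g \<Longrightarrow> j \<in> K \<Longrightarrow> c j = C / a i \<Longrightarrow> j \<in> exchange_chain K a c C g"

lemma exchange_chain_subset: "exchange_chain K a c C g \<subseteq> K"
proof
  fix i assume "i \<in> exchange_chain K a c C g"
  then show "i \<in> K" by cases auto
qed

text \<open>
  Give the unused value \<open>g\<^sub>1\<close> to the new position \<open>p\<close>, and choose \<open>C\<close> so that the product claimed by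
  \<open>p\<close> is \<open>g\<^sub>1 * z p = C / g\<^sub>2\<close>. Reflecting the chain that starts at the owner of this product repairs
  all collisions of products. No collision of values is created: along the chain
  each position receives the value of its predecessor, and the first one receives the other
  unused value \<open>g\<^sub>2\<close>.
\<close>

lemma hall_insert:
  fixes a z :: "'i \<Rightarrow> 'a::field"
  assumes p: "p \<notin> K" "z p \<noteq> 0" and z: "\<And>k. k \<in> K \<Longrightarrow> z k \<noteq> 0"
    and a: "\<And>k. k \<in> K \<Longrightarrow> a k \<noteq> 0" "inj_on a K" "inj_on (\<lambda>k. a k * z k) K"
    and g: "g\<^sub>1 \<noteq> g\<^sub>2" "g\<^sub>1 \<noteq> 0" "g\<^sub>2 \<noteq> 0" "g\<^sub>1 \<notin> a ` K" "g\<^sub>2 \<notin> a ` K"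
  shows "\<exists>u. (\<forall>k\<in>insert p K. u k \<noteq> 0) \<and> inj_on u (insert p K) \<and>
             inj_on (\<lambda>k. u k * z k) (insert p K)"
proof -
  define C where "C = g\<^sub>1 * g\<^sub>2 * z p"
  define c where "c k = a k * z k" for k
  define T where "T = exchange_chain K a c C g\<^sub>2"
  define u where "u k = (if k = p then g\<^sub>1 else if k \<in> T then C / c k else a k)" for k
  have C0: "C \<noteq> 0" using g p by (simp add: C_def)
  have TK: "T \<subseteq> K" unfolding T_def by (rule exchange_chain_subset)
  have c0: "c k \<noteq> 0" if "k \<in> K" for k using that a z by (simp add: c_def)
  have cinj: "inj_on c K" using a(3) by (simp add: c_def[abs_def])
  have closed: "j \<in> T" if "i \<in> T" "j \<in> K" "c j = C / a i" for i j
    using that exchange_chain.step unfolding T_def by metis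
  have start: "j \<in> T" if "j \<in> K" "c j = C / g\<^sub>2" for j
    using that exchange_chain.start unfolding T_def by metis
  (* The owner of C / g2 is reflected to g2, the owner of C / a j to a j. *)
  have val: "C / c i = g\<^sub>2 \<or> (\<exists>j\<in>T. C / c i = a j)" if "i \<in> T" for i
    using that[unfolded T_def]
  proof cases
    case start
    then show ?thesis using C0 by auto
  next
    case (step j)
    then show ?thesis using C0 by (auto simp: T_def)
  qed
  have inj_u: "inj_on u (insert p K)"
  proof -
    have ne: "C / c i \<noteq> a k" if "i \<in> T" "k \<in> K" "k \<notin> T" for i k
      using val[OF that(1)] that TK g(5) inj_onD[OF a(2)] by (metis image_eqI subsetD)
    have ne1: "C / c i \<noteq> g\<^sub>1" if "i \<in> T" for i
      using val[OF that] TK g(1,4) by (metis image_eqI subsetD)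
    have eq: "i = j" if "C / c i = C / c j" "i \<in> T" "j \<in> T" for i j
    proof -
      have "c i = c j" using that C0 c0 TK by (auto simp: divide_simps subset_iff split: if_splits)
      then show ?thesis using inj_onD[OF cinj] that TK by blast
    qed
    show ?thesis
    proof (rule inj_onI)
      fix i j assume "i \<in> insert p K" "j \<in> insert p K" "u i = u j"
      then show "i = j"
        using p(1) TK ne[of i j] ne[of j i] ne1[of i] ne1[of j] eq[of i j] g(4) inj_onD[OF a(2), of i j]
        by (auto simp: u_def split: if_splits)
    qed
  qed
  have uz: "u k * z k = (if k = p then C / g\<^sub>2 else if k \<in> T then C / a k else c k)"
    if "k \<in> insert p K" for k
    using that z[of k] a(1)[of k] g by (auto simp: u_def c_def C_def)
  have inj_uz: "inj_on (\<lambda>k. u k * z k) (insert p K)"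
  proof -
    have ne: "C / a i \<noteq> c k" if "i \<in> T" "k \<in> K" "k \<notin> T" for i k
      using closed that by metis
    have ne1: "C / g\<^sub>2 \<noteq> c k" if "k \<in> K" "k \<notin> T" for k
      using start that by metis
    have ne2: "C / a i \<noteq> C / g\<^sub>2" if "i \<in> T" for i
      using that TK g(3,5) a(1) C0 by (auto simp: divide_simps subset_iff)
    have eq: "i = j" if "C / a i = C / a j" "i \<in> T" "j \<in> T" for i j
    proof -
      have "a i = a j" using that C0 a(1) TK by (auto simp: divide_simps subset_iff split: if_splits)
      then show ?thesis using inj_onD[OF a(2)] that TK by blast
    qed
    show ?thesis
    proof (rule inj_onI)
      fix i j assume ij: "i \<in> insert p K" "j \<in> insert p K" "u i * z i = u j * z j"
      then show "i = j"
        using p(1) TK ne[of i j] ne[of j i] ne1[of i] ne1[of j] ne2[of i] ne2[of j] eq[of i j]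
          inj_onD[OF cinj, of i j]
        unfolding uz[OF ij(1)] uz[OF ij(2)]
        by (auto split: if_splits)
    qed
  qed
  have "u k \<noteq> 0" if "k \<in> insert p K" for k
    using that g C0 a(1) c0 TK by (auto simp: u_def)
  then show ?thesis using inj_u inj_uz by blast
qed

lemma hall_multipliers:
  fixes z :: "'i \<Rightarrow> 'a::{field,finite}"
  assumes "finite K" "card K + 1 < CARD('a)" "\<And>k. k \<in> K \<Longrightarrow> z k \<noteq> 0"
  shows "\<exists>u. (\<forall>k\<in>K. u k \<noteq> 0) \<and> inj_on u K \<and> inj_on (\<lambda>k. u k * z k) K"
  using assms
proof (induction K rule: finite_induct)
  case empty
  then show ?case by simp
next
  case (insert p K)
  then obtain a where a: "\<forall>k\<in>K. a k \<noteq> 0" "inj_on a K" "inj_on (\<lambda>k. a k * z k) K" by auto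
  let ?free = "UNIV - {0} - a ` K"
  have "card (UNIV - {0::'a}) - card (a ` K) \<le> card ?free"
    by (rule diff_card_le_card_Diff) simp
  moreover have "card (a ` K) \<le> card K" by (rule card_image_le) (use insert in auto)
  ultimately have "2 \<le> card ?free" using insert.prems(1) insert.hyps by (simp add: card_Diff_singleton)
  then obtain G where "G \<subseteq> ?free" "card G = 2" by (metis obtain_subset_with_card_n)
  then obtain g\<^sub>1 g\<^sub>2 where "g\<^sub>1 \<in> ?free" "g\<^sub>2 \<in> ?free" "g\<^sub>1 \<noteq> g\<^sub>2" by (auto simp: card_2_iff)
  then show ?case
    using hall_insert[of p K z a g\<^sub>1 g\<^sub>2] insert a by auto
qed

section \<open>Simplex codes\<close>

lemma simplex_code_one_zero:
  assumes "simplex_code W" "x \<in> W" "x \<noteq> 0"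
  obtains i where "\<And>k. x $ k = 0 \<longleftrightarrow> k = i"
proof -
  have "card {k. x $ k = 0} = 1" using assms by (auto simp: simplex_code_def)
  then obtain i where "{k. x $ k = 0} = {i}" by (auto simp: card_1_singleton_iff)
  then show ?thesis using that[of i] by (simp add: set_eq_iff)
qed

lemma simplex_code_two_zeros:
  assumes "simplex_code W" "x \<in> W" "x $ k = 0" "x $ l = 0" "k \<noteq> l"
  shows "x = 0"
proof (rule ccontr)
  assume "x \<noteq> 0"
  then obtain i where "\<And>m. x $ m = 0 \<longleftrightarrow> m = i" using simplex_code_one_zero[OF assms(1,2)] by blast
  then show False using assms(3-5) by simp
qed

text \<open>There are \<open>q - 1\<close> positions off \<open>i\<close> and \<open>j\<close>, exactly as many as non-zero scalars.\<close>

lemma inj_off_two_positions_imp_bij: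
  fixes r :: "'a::{field,finite} option \<Rightarrow> 'a"
  assumes "i \<noteq> j" and inj: "inj_on r (UNIV - {i, j})" and "\<And>k. k \<noteq> i \<Longrightarrow> k \<noteq> j \<Longrightarrow> r k \<noteq> 0"
  shows "bij_betw r (UNIV - {i, j}) (UNIV - {0})"
proof -
  have "card (UNIV - {i, j}) = card (UNIV - {0::'a})"
    using assms(1) by (subst card_Diff_subset) (auto simp: card_UNIV_option card_Diff_singleton)
  moreover have "r ` (UNIV - {i, j}) \<subseteq> UNIV - {0}" using assms(3) by auto
  ultimately have "r ` (UNIV - {i, j}) = UNIV - {0}"
    using card_image[OF inj] by (intro card_subset_eq) auto
  with inj show ?thesis by (simp add: bij_betw_def)
qed

text \<open>
  The ratio of two vectors of a code with different zeros takes every non-zero value exactly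
  once: if positions \<open>k\<close> and \<open>l\<close> shared the value \<open>c\<close>, then \<open>y - c x\<close> would vanish at both.
  The obstruction to short walks is read off from the product of these values, which is
  the same for every code.
\<close>

lemma simplex_code_ratio_bij:
  fixes W :: "('a::{field,finite} ^ 'a option) set"
  assumes W: "simplex_code W" and xy: "x \<in> W" "y \<in> W" "x \<noteq> 0" "y \<noteq> 0"
    and zero: "x $ i = 0" "y $ j = 0" "i \<noteq> j"
  shows "bij_betw (\<lambda>k. y $ k / x $ k) (UNIV - {i, j}) (UNIV - {0})"
proof -
  let ?r = "\<lambda>k. y $ k / x $ k"
  have sub: "vec.subspace W" using W by (simp add: simplex_code_def)
  have x0: "x $ k \<noteq> 0" if "k \<noteq> i" for k
    using simplex_code_two_zeros[OF W xy(1)] zero(1) xy(3) that by blast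
  have y0: "y $ k \<noteq> 0" if "k \<noteq> j" for k
    using simplex_code_two_zeros[OF W xy(2)] zero(2) xy(4) that by blast
  have inj: "inj_on ?r (UNIV - {i, j})"
  proof (rule inj_onI, rule ccontr)
    fix k l assume kl: "k \<in> UNIV - {i, j}" "l \<in> UNIV - {i, j}" "?r k = ?r l" "k \<noteq> l"
    let ?v = "y - ?r k *s x"
    have "?v \<in> W" using sub xy by (intro vec.subspace_diff vec.subspace_scale)
    moreover have "?v $ k = 0" using kl(1) x0 by simp
    moreover have "?v $ l = 0" using kl(2) x0 unfolding kl(3) by simp
    ultimately have "?v = 0" using simplex_code_two_zeros[OF W] kl(4) by blast
    then have "?v $ i = 0" by simp
    then show False using zero y0[of i] by simp
  qed
  show ?thesis
    using x0 y0 by (intro inj_off_two_positions_imp_bij[OF zero(3) inj]) auto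
qed

lemma in_span_pairE:
  fixes x y :: "'a::field ^ 'n::finite"
  assumes "v \<in> vec.span {x, y}"
  obtains \<alpha> \<beta> where "v = \<alpha> *s x + \<beta> *s y"
proof -
  obtain \<alpha> where "v - \<alpha> *s x \<in> vec.span {y}"
    using assms unfolding vec.span_breakdown_eq by blast
  then obtain \<beta> where "v - \<alpha> *s x = \<beta> *s y" unfolding vec.span_singleton by blast
  then have "v = \<alpha> *s x + \<beta> *s y" by (simp add: algebra_simps)
  then show thesis by (rule that)
qed

text \<open>
  Conversely, distinct ratios suffice: a combination \<open>\<alpha> x + \<beta> y\<close> with both coefficients non-zero
  vanishes exactly where the ratio equals \<open>- \<alpha> / \<beta>\<close>, and this happens once because the ratio
  is a bijection onto the non-zero scalars.
\<close>

lemma simplex_code_spanI: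
  fixes x y :: "'a::{field,finite} ^ 'a option"
  assumes ij: "i \<noteq> j" and x: "\<And>k. x $ k = 0 \<longleftrightarrow> k = i" and y: "\<And>k. y $ k = 0 \<longleftrightarrow> k = j"
    and inj: "inj_on (\<lambda>k. y $ k / x $ k) (UNIV - {i, j})"
  shows "simplex_code (vec.span {x, y})"
proof -
  let ?r = "\<lambda>k. y $ k / x $ k"
  have "bij_betw ?r (UNIV - {i, j}) (UNIV - {0})"
    using x y by (intro inj_off_two_positions_imp_bij[OF ij inj]) auto
  then have img: "?r ` (UNIV - {i, j}) = UNIV - {0}" by (rule bij_betw_imp_surj_on)
  have "y \<noteq> 0" using y[of i] ij by auto
  moreover have "x \<notin> vec.span {y}"
  proof
    assume "x \<in> vec.span {y}"
    then obtain \<beta> where "x = \<beta> *s y" by (auto simp: vec.span_singleton)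
    then have "x $ i = \<beta> * y $ i" "x $ j = \<beta> * y $ j" by (metis vector_smult_component)+
    then show False using x[of i] x[of j] y[of i] y[of j] ij by auto
  qed
  ultimately have ind: "vec.independent {x, y}" "x \<noteq> y"
    using vec.independent_insert[of x "{y}"] by (auto simp: vec.span_base)
  then have dim: "vec.dim (vec.span {x, y}) = 2"
    using vec.dim_eq_card_independent[OF ind(1)] by simp
  have "card {k. v $ k = 0} = 1" if v: "v \<in> vec.span {x, y}" "v \<noteq> 0" for v
  proof -
    obtain \<alpha> \<beta> where ab: "v = \<alpha> *s x + \<beta> *s y" using in_span_pairE[OF v(1)] by blast
    have "\<exists>m. {k. v $ k = 0} = {m}"
    proof (cases "\<alpha> = 0 \<or> \<beta> = 0")
      case True
      then show ?thesis using v(2) x y by (auto simp: ab)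
    next
      case False
      then have "- \<alpha> / \<beta> \<in> ?r ` (UNIV - {i, j})" unfolding img by simp
      then obtain m where m: "m \<noteq> i" "m \<noteq> j" "?r m = - \<alpha> / \<beta>" by force
      have iff: "v $ k = 0 \<longleftrightarrow> k \<noteq> i \<and> k \<noteq> j \<and> ?r k = - \<alpha> / \<beta>" for k
      proof (cases "k = i \<or> k = j")
        case True
        then show ?thesis using False x[of i] x[of j] y[of i] y[of j] ij by (auto simp: ab)
      next
        case neq: False
        then have "?r k = - \<alpha> / \<beta> \<longleftrightarrow> \<alpha> * x $ k + \<beta> * y $ k = 0"
          using False x[of k] by (simp add: divide_simps eq_neg_iff_add_eq_0 algebra_simps)
        then show ?thesis using neq by (simp add: ab)
      qed
      have "k = m" if "v $ k = 0" for k
      proof -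
        have k: "k \<in> UNIV - {i, j}" "?r k = - \<alpha> / \<beta>" using that iff[of k] by simp_all
        show ?thesis by (rule inj_onD[OF inj]) (use k m in simp_all)
      qed
      moreover have "v $ m = 0" using m iff[of m] by simp
      ultimately have "{k. v $ k = 0} = {m}" by blast
      then show ?thesis by blast
    qed
    then show ?thesis by auto
  qed
  then show ?thesis using dim by (simp add: simplex_code_def)
qed

text \<open>A plane meets every coordinate hyperplane in a non-zero vector, so the position of the zero can be prescribed.\<close>

lemma simplex_code_vanishing_at:
  assumes "simplex_code W"
  obtains x where "x \<in> W" "x \<noteq> 0" "x $ i = 0"
proof -
  have sub: "vec.subspace W" and dim: "vec.dim W = 2" using assms by (auto simp: simplex_code_def)
  obtain B where B: "B \<subseteq> W" "vec.independent B" "card B = vec.dim W"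
    using vec.basis_exists[of W] by metis
  then obtain u v where uv: "B = {u, v}" "u \<noteq> v" using dim by (auto simp: card_2_iff)
  have u0: "u \<noteq> 0" "v \<noteq> 0" using B(2) vec.dependent_zero uv by auto
  have uW: "u \<in> W" "v \<in> W" using B uv by auto
  show thesis
  proof (cases "u $ i = 0")
    case True
    then show thesis using that u0 uW by blast
  next
    case False
    let ?x = "v - (v $ i / u $ i) *s u"
    have "?x \<in> W" using sub uW by (intro vec.subspace_diff vec.subspace_scale)
    moreover have "?x \<noteq> 0"
    proof
      assume "?x = 0"
      then have "v \<in> vec.span {u}" by (auto simp: vec.span_singleton)
      then show False using B(2) uv vec.independent_insert[of v "{u}"] by (auto simp: insert_commute)
    qed
    moreover have "?x $ i = 0" using False by simp
    ultimately show thesis using that by blast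
  qed
qed

section \<open>Points of lines and the diagonal action\<close>

lemma proj_point_iff: "proj_point P \<longleftrightarrow> (\<exists>x. x \<noteq> 0 \<and> P = vec.span {x})"
proof
  assume P: "proj_point P"
  then obtain B where B: "B \<subseteq> P" "vec.independent B" "P \<subseteq> vec.span B" "card B = 1"
    using vec.basis_exists[of P] by (metis proj_point_def)
  then obtain x where x: "B = {x}" by (auto simp: card_1_singleton_iff)
  have "vec.span B \<subseteq> P" using B P by (simp add: vec.span_minimal proj_point_def)
  then have "P = vec.span {x}" using B x by simp
  moreover have "x \<noteq> 0" using B(2) vec.dependent_zero x by auto
  ultimately show "\<exists>x. x \<noteq> 0 \<and> P = vec.span {x}" by blast
qed (auto simp: proj_point_def)

lemma span_in_proj_points_of:
  assumes "vec.subspace W" "x \<in> W" "x \<noteq> 0"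
  shows "vec.span {x} \<in> proj_points_of W"
  using assms by (auto simp: proj_points_of_def proj_point_iff vec.span_minimal)

lemma proj_points_of_eq:
  assumes "vec.subspace W"
  shows "proj_points_of W = {vec.span {x} | x. x \<in> W \<and> x \<noteq> 0}"
  using span_in_proj_points_of[OF assms] vec.span_base
  by (fastforce simp: proj_points_of_def proj_point_iff)

lemma common_point_vector:
  assumes "P \<in> proj_points_of W" "P \<in> proj_points_of W'"
  obtains x where "x \<in> W" "x \<in> W'" "x \<noteq> 0"
proof -
  obtain x where "x \<noteq> 0" "P = vec.span {x}" using assms(1) by (auto simp: proj_points_of_def proj_point_iff)
  moreover from this have "x \<in> P" by (simp add: vec.span_base)
  ultimately show thesis using assms that by (auto simp: proj_points_of_def)
qed

lemma distinct_planes_meet_in_one_point: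
  assumes W: "vec.subspace W" "vec.dim W = 2" and W': "vec.subspace W'" "vec.dim W' = 2"
    and x: "x \<in> W" "x \<in> W'" "x \<noteq> 0" and ne: "W \<noteq> W'"
  shows "proj_points_of W \<inter> proj_points_of W' = {vec.span {x}}"
proof -
  let ?I = "W \<inter> W'"
  have sub: "vec.subspace ?I" using W W' by (simp add: vec.subspace_inter)
  have "vec.dim ?I \<le> 1"
  proof (rule ccontr)
    assume "\<not> vec.dim ?I \<le> 1"
    then have "?I = W" "?I = W'"
      using vec.subspace_dim_equal[of ?I W] vec.subspace_dim_equal[of ?I W'] sub W W' by auto
    then show False using ne by simp
  qed
  then have eqI: "P = ?I" if "P \<subseteq> ?I" "proj_point P" for P
    using vec.subspace_dim_equal[of P ?I] sub that by (auto simp: proj_point_def)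
  have x': "vec.span {x} \<in> proj_points_of W \<inter> proj_points_of W'"
    using span_in_proj_points_of W W' x by blast
  then have "P = vec.span {x}" if "P \<in> proj_points_of W \<inter> proj_points_of W'" for P
    using eqI[of P] eqI[of "vec.span {x}"] that by (auto simp: proj_points_of_def)
  then show ?thesis using x' by blast
qed

lemma diag_mat_mult_nth [simp]: "(diag_mat d *v x) $ k = d k * x $ k"
  by (simp add: diag_mat_def matrix_vector_mult_def if_distrib[of "\<lambda>t. t * _"] cong: if_cong)

lemma inj_diag_mat:
  assumes "\<And>k. d k \<noteq> 0"
  shows "inj ((*v) (diag_mat d))"
  using assms by (auto simp: inj_def vec_eq_iff)

lemma simplex_code_diag_image:
  assumes W: "simplex_code W" and d: "\<And>k. d k \<noteq> 0"
  shows "simplex_code ((*v) (diag_mat d) ` W)"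
proof -
  have "vec.dim ((*v) (diag_mat d) ` W) = vec.dim W"
    using inj_on_subset[OF inj_diag_mat[of d], OF d subset_UNIV]
    by (intro vec.dim_image_eq) auto
  moreover have "vec.subspace ((*v) (diag_mat d) ` W)"
    using W by (simp add: simplex_code_def vec.subspace_image)
  moreover have "card {k. (diag_mat d *v x) $ k = 0} = 1" if "x \<in> W" "diag_mat d *v x \<noteq> 0" for x
    using that W d by (auto simp: simplex_code_def)
  ultimately show ?thesis using W by (auto simp: simplex_code_def)
qed

lemma matrix_image_proj_points_of:
  assumes W: "vec.subspace W" and d: "\<And>k. d k \<noteq> 0"
  shows "matrix_image (diag_mat d) (proj_points_of W) = proj_points_of ((*v) (diag_mat d) ` W)"
proof -
  have D0: "diag_mat d *v x = 0 \<longleftrightarrow> x = 0" for x using d by (auto simp: vec_eq_iff)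
  have "(*v) (diag_mat d) ` vec.span {x} = vec.span {diag_mat d *v x}" for x
    using vec.span_image[of "diag_mat d" "{x}"] by simp
  then show ?thesis
    unfolding matrix_image_def proj_points_of_eq[OF W] proj_points_of_eq[OF vec.subspace_image[OF W]]
    using D0 by (auto simp: image_def) blast+
qed

section \<open>The line L\<close>

lemma simplex_code_L: "simplex_code (vec.span {A_vec None, A_vec (Some (0::'a::{field,finite}))})"
proof (rule simplex_code_spanI[where i = None and j = "Some 0"])
  show "inj_on (\<lambda>k. A_vec (Some 0) $ k / A_vec None $ k) (UNIV - {None, Some (0::'a)})"
    by (auto simp: inj_on_def split: option.splits)
qed (auto split: option.splits)

lemma line_L_eq: "line_L = proj_points_of (vec.span {A_vec None, A_vec (Some (0::'a::{field,finite}))})"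
proof -
  let ?W = "vec.span {A_vec None, A_vec (Some (0::'a))}"
  have A: "A_vec (Some t) = A_vec (Some 0) + t *s A_vec None" for t :: 'a
    by (auto simp: vec_eq_iff split: option.splits)
  have AW: "A_vec t \<in> ?W" for t
  proof (cases t)
    case None
    then show ?thesis by (simp add: vec.span_base)
  next
    case (Some s)
    show ?thesis
      unfolding Some A[of s] by (intro vec.span_add vec.span_scale vec.span_base) auto
  qed
  have A0: "A_vec t \<noteq> (0 :: 'a ^ 'a option)" for t
  proof (cases t)
    case None
    then have "A_vec t $ Some 0 = (1::'a)" by simp
    then show ?thesis by auto
  next
    case (Some s)
    then have "A_vec t $ None = (1::'a)" by simp
    then show ?thesis by auto
  qed
  have span_scale: "vec.span {c *s v} = vec.span {v}" if "c \<noteq> 0" for c :: 'a and v :: "'a ^ 'a option"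
  proof
    show "vec.span {c *s v} \<subseteq> vec.span {v}"
      by (intro vec.span_minimal) (auto intro: vec.span_scale vec.span_base)
    have "v = (1 / c) *s (c *s v)" using that by simp
    then have "v \<in> vec.span {c *s v}" by (metis vec.span_scale vec.span_base singletonI)
    then show "vec.span {v} \<subseteq> vec.span {c *s v}" by (intro vec.span_minimal) auto
  qed
  have "\<exists>t. vec.span {x} = vec.span {A_vec t}" if x: "x \<in> ?W" "x \<noteq> 0" for x
  proof -
    obtain \<alpha> \<beta> where xe: "x = \<alpha> *s A_vec None + \<beta> *s A_vec (Some 0)"
      using in_span_pairE[OF x(1)] by blast
    show ?thesis
    proof (cases "\<beta> = 0")
      case True
      then have "\<alpha> \<noteq> 0" using x(2) xe by auto
      then have "vec.span {x} = vec.span {A_vec None}" using True xe span_scale by simp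
      then show ?thesis by blast
    next
      case False
      have "x = \<beta> *s A_vec (Some (\<alpha> / \<beta>))"
        using False by (simp add: xe A[of "\<alpha> / \<beta>"] vec.scale_right_distrib del: A_vec.simps)
      then have "vec.span {x} = vec.span {A_vec (Some (\<alpha> / \<beta>))}" using False span_scale by simp
      then show ?thesis by blast
    qed
  qed
  then show ?thesis
    unfolding line_L_def proj_points_of_eq[OF vec.subspace_span] using AW A0 by (auto simp del: A_vec.simps)
qed


lemma line_L_in_simplex_lines: "line_L \<in> simplex_lines"
  unfolding line_L_eq simplex_lines_def using simplex_code_L by blast

section \<open>Diagonal images at distance at least three\<close>

text \<open>
  In a simplex code the vectors with a given zero are proportional. Applied in \<open>W\<close> to \<open>x, y\<close> and
  in \<open>N\<close> to \<open>x, D y\<close>, this makes \<open>D\<close> act as a scalar off \<open>i\<close>.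
\<close>

lemma diag_constant_of_same_zero:
  assumes W: "simplex_code W" and N: "simplex_code N"
    and x: "x \<in> W" "x \<in> N" "x \<noteq> 0" "x $ i = 0"
    and y: "y \<in> W" "diag_mat d *v y \<in> N" "y \<noteq> 0" "y $ i = 0"
    and kl: "k \<noteq> i" "l \<noteq> i"
  shows "d k = d l"
proof -
  have proportional: "v $ k * u $ l = u $ k * v $ l"
    if "simplex_code U" "u \<in> U" "v \<in> U" "u $ i = 0" "v $ i = 0" for U u v
  proof -
    have "u $ l *s v - v $ l *s u \<in> U"
      using that by (intro vec.subspace_diff vec.subspace_scale) (auto simp: simplex_code_def)
    then have "u $ l *s v - v $ l *s u = 0"
      using that(4,5) kl(2) by (intro simplex_code_two_zeros[OF that(1), of _ i l]) simp_all
    then have "(u $ l *s v - v $ l *s u) $ k = 0" by simp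
    then show ?thesis by (simp add: mult.commute)
  qed
  have 1: "y $ k * x $ l = x $ k * y $ l" using proportional[OF W x(1) y(1)] x y by simp
  have 2: "d k * y $ k * x $ l = x $ k * (d l * y $ l)" using proportional[OF N x(2) y(2)] x y by simp
  have nz: "x $ k \<noteq> 0" "y $ l \<noteq> 0"
    using simplex_code_two_zeros[OF W] x y kl by metis+
  have "d k * (x $ k * y $ l) = d k * (y $ k * x $ l)" by (simp only: 1)
  also have "\<dots> = d l * (x $ k * y $ l)" using 2 by (simp add: ac_simps)
  finally have "d k * (x $ k * y $ l) = d l * (x $ k * y $ l)" .
  then show ?thesis using nz by simp
qed

text \<open>
  The entries of \<open>y / x\<close> and of \<open>D y / x\<close> both run once through the non-zero scalars, the former
  because of \<open>W\<close> and the latter because of \<open>N\<close>; compare the two products.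
\<close>

lemma diag_product_of_distinct_zeros:
  assumes W: "simplex_code W" and N: "simplex_code N" and d: "\<And>k. d k \<noteq> 0"
    and x: "x \<in> W" "x \<in> N" "x \<noteq> 0" "x $ i = 0"
    and y: "y \<in> W" "diag_mat d *v y \<in> N" "y \<noteq> 0" "y $ j = 0"
    and ij: "i \<noteq> j"
  shows "(\<Prod>k\<in>UNIV - {i, j}. d k) = 1"
proof -
  let ?K = "UNIV - {i, j}" and ?F = "\<Prod>c\<in>UNIV - {0::'a}. c"
  have "diag_mat d *v y \<noteq> 0" using y(3) d by (auto simp: vec_eq_iff)
  then have "bij_betw (\<lambda>k. d k * y $ k / x $ k) ?K (UNIV - {0})"
    using simplex_code_ratio_bij[OF N x(2) y(2) x(3), of i j] x y ij by simp
  from prod.reindex_bij_betw[OF this, of "\<lambda>c. c"]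
  have "?F = (\<Prod>k\<in>?K. d k * y $ k / x $ k)" by simp
  also have "\<dots> = (\<Prod>k\<in>?K. d k) * (\<Prod>k\<in>?K. y $ k / x $ k)"
    by (simp flip: prod.distrib)
  also have "(\<Prod>k\<in>?K. y $ k / x $ k) = ?F"
    using prod.reindex_bij_betw[OF simplex_code_ratio_bij[OF W x(1) y(1) x(3) y(3) x(4) y(4) ij]] .
  finally show ?thesis by simp
qed

lemma no_code_meets_both:
  fixes \<xi> :: "'a::{field,finite}"
  assumes q: "CARD('a) \<ge> 5" and S: "card S = 3"
    and \<xi>: "\<xi> \<noteq> 0" "\<xi> ^ 2 \<noteq> 1" "\<xi> ^ 3 \<noteq> 1"
    and W: "simplex_code W" and N: "simplex_code N"
    and x: "x \<in> W" "x \<in> N" "x \<noteq> 0"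
    and y: "y \<in> N" "y \<in> (*v) (diag_mat (\<lambda>k. if k \<in> S then \<xi> else 1)) ` W" "y \<noteq> 0"
  shows False
proof -
  let ?d = "\<lambda>k. if k \<in> S then \<xi> else 1"
  have finS: "finite S" using S by (metis card.infinite zero_neq_numeral)
  have \<xi>1: "\<xi> \<noteq> 1" using \<xi>(2) by auto
  obtain w where w: "w \<in> W" "y = diag_mat ?d *v w" using y(2) by auto
  then have w0: "w \<noteq> 0" using y(3) by auto
  obtain i where i: "x $ i = 0" using simplex_code_one_zero[OF W x(1,3)] by metis
  obtain j where j: "w $ j = 0" using simplex_code_one_zero[OF W w(1) w0] by metis
  show False
  proof (cases "i = j")
    case True
    have "card (S - {i}) \<ge> 2" using S finS by (simp add: card_Diff_singleton_if)
    then have "S - {i} \<noteq> {}" by (metis card.empty not_numeral_le_zero)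
    then obtain k where k: "k \<in> S" "k \<noteq> i" by blast
    have "card (insert i S) \<le> 4" using S finS by (simp add: card_insert_if)
    also have "\<dots> < card (UNIV :: 'a option set)" using q by (simp add: card_UNIV_option)
    finally have "insert i S \<noteq> UNIV" by auto
    then obtain l where l: "l \<notin> S" "l \<noteq> i" by blast
    have "?d k = ?d l"
      using diag_constant_of_same_zero[OF W N x i, of w ?d k l] w w0 y(1) j True k l by simp
    then show False using k l \<xi>1 by simp
  next
    case False
    have "1 = (\<Prod>k\<in>UNIV - {i, j}. ?d k)"
      using diag_product_of_distinct_zeros[OF W N _ x i, of ?d w j] \<xi>(1) w w0 y(1) j False by simp
    also have "\<dots> = \<xi> ^ card (S - {i, j})"
    proof -
      have "(\<Prod>k\<in>UNIV - {i, j}. ?d k) = (\<Prod>k\<in>S - {i, j}. \<xi>)"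
        by (rule prod.mono_neutral_cong_right) auto
      then show ?thesis by simp
    qed
    (* At most two of the three positions of S are removed, so only the exponents 1, 2, 3 occur. *)
    finally have "\<xi> ^ card (S - {i, j}) = 1" by simp
    moreover have "card (S - {i, j}) \<in> {1, 2, 3}"
    proof -
      have "card S - card {i, j} \<le> card (S - {i, j})" by (rule diff_card_le_card_Diff) simp
      moreover have "card (S - {i, j}) \<le> card S" using finS by (simp add: card_mono)
      ultimately show ?thesis using S False by auto
    qed
    ultimately show False using \<xi> \<xi>1 by auto
  qed
qed

section \<open>Any two codes are joined by a chain of length three\<close>

text \<open>
  The first and the last link of the chain are codes meeting \<open>W\<close> in \<open>x\<close> and \<open>W'\<close> in \<open>y\<close>; they share
  the vector \<open>p\<close>. The zeros of \<open>x\<close>, \<open>y\<close> and \<open>p\<close> are put at three different positions \<open>i\<close>, \<open>j\<close> and \<open>l\<close>,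
  so that only \<open>q - 2\<close> positions carry both ratios \<open>p / x\<close> and \<open>p / y\<close>; with \<open>i = j\<close> there would be
  \<open>q - 1\<close> of them, and the product of \<open>x / y\<close> would become an obstruction.
\<close>

lemma simplex_chain_of_length_three:
  fixes W W' :: "('a::{field,finite} ^ 'a option) set"
  assumes W: "simplex_code W" and W': "simplex_code W'"
  obtains N N' x p y where "simplex_code N" "simplex_code N'"
    "x \<in> W" "x \<in> N" "x \<noteq> 0" "p \<in> N" "p \<in> N'" "p \<noteq> 0" "y \<in> N'" "y \<in> W'" "y \<noteq> 0"
proof -
  have "card {0, 1::'a} \<le> CARD('a)" by (rule card_mono) auto
  then have q: "CARD('a) \<ge> 2" by simp
  let ?i = "None :: 'a option" and ?j = "Some (0::'a)" and ?l = "Some (1::'a)"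
  let ?K = "UNIV - {?i, ?j, ?l}"
  obtain x where x: "x \<in> W" "x \<noteq> 0" "x $ ?i = 0" by (rule simplex_code_vanishing_at[OF W])
  obtain y where y: "y \<in> W'" "y \<noteq> 0" "y $ ?j = 0" by (rule simplex_code_vanishing_at[OF W'])
  have x0: "x $ k = 0 \<longleftrightarrow> k = ?i" for k using simplex_code_two_zeros[OF W x(1)] x by metis
  have y0: "y $ k = 0 \<longleftrightarrow> k = ?j" for k using simplex_code_two_zeros[OF W' y(1)] y by metis
  have cardK: "card ?K = CARD('a) - 2" by (subst card_Diff_subset) (auto simp: card_UNIV_option)
  define z where "z k = x $ k / y $ k" for k
  have "\<exists>u. (\<forall>k\<in>?K. u k \<noteq> 0) \<and> inj_on u ?K \<and> inj_on (\<lambda>k. u k * z k) ?K"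
    using q cardK by (intro hall_multipliers) (auto simp: z_def x0 y0)
  then obtain u where u: "\<And>k. k \<in> ?K \<Longrightarrow> u k \<noteq> 0" "inj_on u ?K" "inj_on (\<lambda>k. u k * z k) ?K" by blast
  have missing: "\<exists>g. g \<noteq> 0 \<and> g \<notin> f ` ?K" for f :: "'a option \<Rightarrow> 'a"
  proof -
    have "card (insert 0 (f ` ?K)) \<le> Suc (card ?K)"
      by (metis card_image_le card_insert_le_m1 diff_Suc_1 finite zero_less_Suc)
    also have "\<dots> < CARD('a)" using q cardK by simp
    finally have "insert 0 (f ` ?K) \<noteq> UNIV" by auto
    then show ?thesis by blast
  qed
  obtain g where g: "g \<noteq> 0" "g \<notin> u ` ?K" using missing by blast
  obtain h where h: "h \<noteq> 0" "h \<notin> (\<lambda>k. u k * z k) ` ?K" using missing by blast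
  (* The ratio p / x is u completed by g at j, and p / y is u * z completed by h at i. *)
  define p :: "'a ^ 'a option" where
    "p = (\<chi> k. if k = ?l then 0 else if k = ?j then g * x $ k else if k = ?i then h * y $ k else u k * x $ k)"
  have p0: "p $ k = 0 \<longleftrightarrow> k = ?l" for k using g h u(1)[of k] by (auto simp: p_def x0 y0)
  have px: "p $ k / x $ k = (if k = ?j then g else u k)" if "k \<in> UNIV - {?i, ?l}" for k
    using that by (auto simp: p_def x0)
  have py: "p $ k / y $ k = (if k = ?i then h else u k * z k)" if "k \<in> UNIV - {?j, ?l}" for k
    using that by (auto simp: p_def y0 z_def)
  have inj_insert: "inj_on (\<lambda>k. if k = m then c else f k) (insert m ?K)"
    if "inj_on f ?K" "c \<notin> f ` ?K" for m c and f :: "'a option \<Rightarrow> 'a"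
  proof (rule inj_onI)
    fix a b assume "a \<in> insert m ?K" "b \<in> insert m ?K"
      "(if a = m then c else f a) = (if b = m then c else f b)"
    then show "a = b"
      using that(2) inj_onD[OF that(1), of a b] by (auto split: if_splits)
  qed
  have "inj_on (\<lambda>k. p $ k / x $ k) (UNIV - {?i, ?l})"
  proof -
    have "insert ?j ?K = UNIV - {?i, ?l}" by auto
    then show ?thesis using inj_insert[OF u(2) g(2), of ?j] by (subst inj_on_cong[OF px]) simp_all
  qed
  then have N: "simplex_code (vec.span {x, p})" using simplex_code_spanI[of ?i ?l x p] x0 p0 by simp
  have "inj_on (\<lambda>k. p $ k / y $ k) (UNIV - {?j, ?l})"
  proof -
    have "insert ?i ?K = UNIV - {?j, ?l}" by auto
    then show ?thesis using inj_insert[OF u(3) h(2), of ?i] by (subst inj_on_cong[OF py]) simp_all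
  qed
  then have N': "simplex_code (vec.span {y, p})" using simplex_code_spanI[of ?j ?l y p] y0 p0 by simp
  have "p \<noteq> 0" using p0[of ?i] by auto
  then show thesis using that[OF N N', of x p y] x y by (simp add: vec.span_base)
qed

section \<open>Distances in the graph\<close>

lemma simplex_linesE:
  assumes "l \<in> simplex_lines"
  obtains W where "simplex_code W" "l = proj_points_of W"
  using assms by (auto simp: simplex_lines_def)

lemma simplex_code_in_lines: "simplex_code W \<Longrightarrow> proj_points_of W \<in> simplex_lines"
  by (auto simp: simplex_lines_def)

lemma verts_simplex_graph: "pverts simplex_graph = simplex_lines"
  by (simp add: simplex_graph_def)

lemma arcs_simplex_graph:
  "(l, m) \<in> parcs simplex_graph \<longleftrightarrow>
    l \<in> simplex_lines \<and> m \<in> simplex_lines \<and> l \<noteq> m \<and> (\<exists>P. l \<inter> m = {P})"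
  by (simp add: simplex_graph_def)

lemma simplex_walk_of_common_vector:
  fixes W N :: "('a::{field,finite} ^ 'a option) set"
  assumes W: "simplex_code W" and N: "simplex_code N" and x: "x \<in> W" "x \<in> N" "x \<noteq> 0"
  obtains e where "pre_digraph.awalk (with_proj simplex_graph) (proj_points_of W) e (proj_points_of N)"
    "length e \<le> 1"
proof -
  interpret graph "with_proj (simplex_graph :: ('a ^ 'a option) set set pair_pre_digraph)"
    by (rule graph_simplex_graph)
  let ?l = "proj_points_of W" and ?m = "proj_points_of N"
  have lines: "?l \<in> simplex_lines" "?m \<in> simplex_lines" using W N by (simp_all add: simplex_code_in_lines)
  show thesis
  proof (cases "?l = ?m")
    case True
    then show thesis using that[of "[]"] lines by (simp add: awalk_Nil_iff verts_simplex_graph)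
  next
    case False
    then have "W \<noteq> N" by auto
    then have "\<exists>P. ?l \<inter> ?m = {P}"
      using distinct_planes_meet_in_one_point[of W N x] W N x by (auto simp: simplex_code_def)
    then have "awalk ?l [(?l, ?m)] ?m"
      using lines False by (simp add: awalk_simps verts_simplex_graph arcs_simplex_graph)
    then show thesis using that by simp
  qed
qed

lemma simplex_dist_le_3:
  fixes l m :: "('a::{field,finite} ^ 'a option) set set"
  assumes "l \<in> simplex_lines" "m \<in> simplex_lines"
  shows "graph_dist (with_proj simplex_graph) l m \<le> 3"
proof -
  interpret graph "with_proj (simplex_graph :: ('a ^ 'a option) set set pair_pre_digraph)"
    by (rule graph_simplex_graph)
  obtain W where W: "simplex_code W" "l = proj_points_of W" by (rule simplex_linesE[OF assms(1)])
  obtain W' where W': "simplex_code W'" "m = proj_points_of W'" by (rule simplex_linesE[OF assms(2)])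
  obtain N N' x p y where N: "simplex_code N" "simplex_code N'"
    "x \<in> W" "x \<in> N" "x \<noteq> 0" "p \<in> N" "p \<in> N'" "p \<noteq> 0" "y \<in> N'" "y \<in> W'" "y \<noteq> 0"
    by (rule simplex_chain_of_length_three[OF W(1) W'(1)])
  obtain e\<^sub>1 where e1: "awalk l e\<^sub>1 (proj_points_of N)" "length e\<^sub>1 \<le> 1"
    using simplex_walk_of_common_vector[OF W(1) N(1,3-5)] W(2) by metis
  obtain e\<^sub>2 where e2: "awalk (proj_points_of N) e\<^sub>2 (proj_points_of N')" "length e\<^sub>2 \<le> 1"
    using simplex_walk_of_common_vector[OF N(1,2,6-8)] by metis
  obtain e\<^sub>3 where e3: "awalk (proj_points_of N') e\<^sub>3 m" "length e\<^sub>3 \<le> 1"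
    using simplex_walk_of_common_vector[OF N(2) W'(1) N(9-11)] W'(2) by metis
  let ?e = "e\<^sub>1 @ e\<^sub>2 @ e\<^sub>3"
  have "awalk l ?e m" using e1(1) e2(1) e3(1) by (meson awalk_appendI)
  then have "graph_dist (with_proj simplex_graph) l m \<le> awalk_cost (\<lambda>_. 1) ?e"
    unfolding graph_dist_def by (rule min_cost_le_walk_cost)
  also have "\<dots> \<le> 3"
    using e1(2) e2(2) e3(2) by (simp add: awalk_cost_def sum_list_triv)
  finally show ?thesis .
qed

text \<open>Walks of length 0 or 1 are included by taking \<open>N = W\<close> as the intermediate code.\<close>

lemma short_walk_imp_code_meeting_both:
  fixes W W' :: "('a::{field,finite} ^ 'a option) set"
  assumes "pre_digraph.awalk (with_proj simplex_graph) (proj_points_of W) e (proj_points_of W')"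
    and "length e \<le> 2"
    and W: "simplex_code W" and W': "simplex_code W'"
  obtains N x y where "simplex_code N" "x \<in> W" "x \<in> N" "x \<noteq> 0" "y \<in> N" "y \<in> W'" "y \<noteq> 0"
proof -
  interpret graph "with_proj (simplex_graph :: ('a ^ 'a option) set set pair_pre_digraph)"
    by (rule graph_simplex_graph)
  let ?l = "proj_points_of W" and ?m = "proj_points_of W'"
  have point: "\<exists>P. P \<in> proj_points_of U" if U: "simplex_code U" for U :: "('a ^ 'a option) set"
  proof -
    obtain v where "v \<in> U" "v \<noteq> 0" by (rule simplex_code_vanishing_at[OF U])
    then show ?thesis using span_in_proj_points_of[of U v] U by (auto simp: simplex_code_def)
  qed
  have "\<exists>n \<in> simplex_lines. ?l \<inter> n \<noteq> {} \<and> n \<inter> ?m \<noteq> {}"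
  proof -
    consider "e = []" | a where "e = [a]" | a b where "e = [a, b]"
      using assms(2) by (cases e; cases "tl e") auto
    then show ?thesis
    proof cases
      case 1
      then have "?l = ?m" using assms(1) by (simp add: awalk_simps)
      then show ?thesis using point[OF W] simplex_code_in_lines[OF W] by blast
    next
      case 2
      then have "?l \<inter> ?m \<noteq> {}"
        using assms(1) by (cases a) (auto simp: awalk_simps verts_simplex_graph arcs_simplex_graph)
      then show ?thesis using point[OF W] simplex_code_in_lines[OF W] by blast
    next
      case 3
      then have "fst b \<in> simplex_lines" "?l \<inter> fst b \<noteq> {}" "fst b \<inter> ?m \<noteq> {}"
        using assms(1) by (cases a, cases b, auto simp: awalk_simps verts_simplex_graph arcs_simplex_graph)+
      then show ?thesis by blast
    qed
  qed
  then obtain N P Q where N: "simplex_code N"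
    and P: "P \<in> ?l" "P \<in> proj_points_of N" and Q: "Q \<in> proj_points_of N" "Q \<in> ?m"
    by (auto elim!: simplex_linesE)
  obtain x where "x \<in> W" "x \<in> N" "x \<noteq> 0" by (rule common_point_vector[OF P])
  moreover obtain y where "y \<in> N" "y \<in> W'" "y \<noteq> 0" by (rule common_point_vector[OF Q])
  ultimately show thesis using that N by blast
qed

text \<open>
  The obstruction concerns the first three powers of \<open>\<xi>\<close> only. In this form it covers the
  generators as well as the scalar that witnesses the lower bound for the diameter.
\<close>

lemma line_M_in_lines_at_distance_3:
  fixes \<xi> :: "'a::{field,finite}"
  assumes q: "CARD('a) \<ge> 5" and S: "card S = 3"
    and \<xi>: "\<xi> \<noteq> 0" "\<xi> ^ 2 \<noteq> 1" "\<xi> ^ 3 \<noteq> 1"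
  shows "line_M \<xi> S \<in> simplex_lines"
    and "graph_dist (with_proj simplex_graph) line_L (line_M \<xi> S) = 3"
proof -
  interpret graph "with_proj (simplex_graph :: ('a ^ 'a option) set set pair_pre_digraph)"
    by (rule graph_simplex_graph)
  let ?W = "vec.span {A_vec None, A_vec (Some (0::'a))}"
  let ?d = "\<lambda>k. if k \<in> S then \<xi> else 1"
  let ?W' = "(*v) (diag_mat ?d) ` ?W"
  have d: "?d k \<noteq> 0" for k using \<xi>(1) by simp
  note W = simplex_code_L[where 'a = 'a]
  note W' = simplex_code_diag_image[OF W, of ?d, OF d]
  have L: "line_L = proj_points_of ?W" by (rule line_L_eq)
  have M: "line_M \<xi> S = proj_points_of ?W'"
    unfolding line_M_def L using matrix_image_proj_points_of[OF vec.subspace_span, of ?d] d by blast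
  show M_line: "line_M \<xi> S \<in> simplex_lines" unfolding M by (rule simplex_code_in_lines[OF W'])
  have "3 \<le> awalk_cost (\<lambda>_. 1) e" if e: "awalk line_L e (line_M \<xi> S)" for e
  proof (rule ccontr)
    assume "\<not> 3 \<le> awalk_cost (\<lambda>_. 1) e"
    then have "length e \<le> 2" by (simp add: awalk_cost_def sum_list_triv)
    then obtain N x y where "simplex_code N" "x \<in> ?W" "x \<in> N" "x \<noteq> 0" "y \<in> N" "y \<in> ?W'" "y \<noteq> 0"
      using short_walk_imp_code_meeting_both[OF _ _ W W'] e unfolding L M by metis
    then show False using no_code_meets_both[OF q S \<xi> W] by blast
  qed
  then have "3 \<le> graph_dist (with_proj simplex_graph) line_L (line_M \<xi> S)"
    unfolding graph_dist_def \<mu>_def by (intro INF_greatest) auto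
  then show "graph_dist (with_proj simplex_graph) line_L (line_M \<xi> S) = 3"
    using simplex_dist_le_3[OF line_L_in_simplex_lines M_line] by (simp add: antisym)
qed

section \<open>Suitable scalars\<close>

text \<open>The polynomial \<open>X\<^sup>m - 1\<close> has at most \<open>m \<le> 3\<close> roots, but there are at least four units.\<close>

lemma exists_unit_power_ne_1:
  assumes q: "CARD('a::{field,finite}) \<ge> 5" and m: "0 < m" "m \<le> 3"
  shows "\<exists>x::'a. x \<noteq> 0 \<and> x ^ m \<noteq> 1"
proof (rule ccontr)
  assume "\<nexists>x::'a. x \<noteq> 0 \<and> x ^ m \<noteq> 1"
  then have all: "x ^ m = 1" if "x \<noteq> 0" for x :: 'a using that by blast
  let ?p = "monom 1 m - 1 :: 'a poly"
  have deg: "degree ?p \<le> m" by (intro degree_diff_le degree_monom_le) simp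
  have "poly ?p 0 \<noteq> 0" using m by (simp add: poly_monom zero_power)
  then have p0: "?p \<noteq> 0" by auto
  have "card (UNIV - {0::'a}) \<le> card {x. poly ?p x = 0}"
    using all by (intro card_mono) (auto simp: poly_monom)
  also have "\<dots> \<le> m" using card_poly_roots_bound[OF p0] deg by simp
  finally show False using q m by (simp add: card_Diff_singleton)
qed

text \<open>If \<open>\<xi> ^ m = 1\<close> for a generator \<open>\<xi>\<close>, then \<open>x ^ m = 1\<close> for every unit \<open>x\<close>.\<close>

lemma generator_powers_ne_1:
  fixes \<xi> :: "'a::{field,finite}"
  assumes q: "CARD('a) \<ge> 5" and gen: "generates_units \<xi>" and m: "0 < m" "m \<le> 3"
  shows "\<xi> ^ m \<noteq> 1"
proof
  assume \<xi>m: "\<xi> ^ m = 1"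
  obtain x :: 'a where x: "x \<noteq> 0" "x ^ m \<noteq> 1" using exists_unit_power_ne_1[OF q m] by blast
  have "x \<in> range (\<lambda>k::int. \<xi> powi k)" using gen x(1) unfolding generates_units_def by blast
  then obtain k :: int where "x = \<xi> powi k" by blast
  then have "x ^ m = \<xi> powi (int m * k)" by (simp only: power_int_power' mult.commute[of k])
  also have "\<dots> = (\<xi> ^ m) powi k" by (rule power_int_power[symmetric])
  finally show False using x(2) \<xi>m by simp
qed

text \<open>
  The solutions of \<open>x\<^sup>2 = 1\<close> and those of \<open>x\<^sup>3 = 1\<close> form two proper subgroups of the group of
  units, and a group is never the union of two proper subgroups.
\<close>

lemma exists_scalar_with_square_and_cube_ne_1:
  assumes q: "CARD('a::{field,finite}) \<ge> 5"
  shows "\<exists>\<xi>::'a. \<xi> \<noteq> 0 \<and> \<xi> ^ 2 \<noteq> 1 \<and> \<xi> ^ 3 \<noteq> 1"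
proof -
  from exists_unit_power_ne_1[OF q, of 2] exists_unit_power_ne_1[OF q, of 3] obtain x y :: 'a
    where x: "x \<noteq> 0" "x ^ 2 \<noteq> 1" and y: "y \<noteq> 0" "y ^ 3 \<noteq> 1" by auto
  show ?thesis
  proof (cases "x ^ 3 = 1 \<and> y ^ 2 = 1")
    case True
    then have "(x * y) ^ 2 = x ^ 2" "(x * y) ^ 3 = y ^ 3" by (simp_all add: power_mult_distrib)
    then show ?thesis using x y by (intro exI[of _ "x * y"]) auto
  next
    case False
    then show ?thesis using x y by blast
  qed
qed

theorem proposition3p2:
  assumes "CARD('a::{field,finite}) \<ge> 5"
  shows "(line_L :: ('a ^ 'a option) set set) \<in> simplex_lines \<and>
    (\<forall>(\<xi>::'a) (S::'a option set). generates_units \<xi> \<and> card S = 3 \<longrightarrow>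
       line_M \<xi> S \<in> simplex_lines \<and>
       graph_dist (with_proj simplex_graph) line_L (line_M \<xi> S) = 3) \<and>
    graph_diam (with_proj (simplex_graph :: ('a ^ 'a option) set set pair_pre_digraph)) = 3"
proof (intro conjI allI impI)
  show "(line_L :: ('a ^ 'a option) set set) \<in> simplex_lines"
    by (rule line_L_in_simplex_lines)
next
  fix \<xi> :: 'a and S :: "'a option set"
  assume *: "generates_units \<xi> \<and> card S = 3"
  then have "\<xi> \<noteq> 0" "\<xi> ^ 2 \<noteq> 1" "\<xi> ^ 3 \<noteq> 1"
    using generator_powers_ne_1[OF assms, of \<xi>] by (auto simp: generates_units_def)
  then show "line_M \<xi> S \<in> simplex_lines"
    and "graph_dist (with_proj simplex_graph) line_L (line_M \<xi> S) = 3"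
    using line_M_in_lines_at_distance_3[OF assms] * by auto
next
  let ?G = "with_proj (simplex_graph :: ('a ^ 'a option) set set pair_pre_digraph)"
  obtain \<xi> :: 'a where \<xi>: "\<xi> \<noteq> 0" "\<xi> ^ 2 \<noteq> 1" "\<xi> ^ 3 \<noteq> 1"
    using exists_scalar_with_square_and_cube_ne_1[OF assms] by blast
  obtain S :: "'a option set" where S: "card S = 3"
    using obtain_subset_with_card_n[of 3 "UNIV :: 'a option set"] assms by (auto simp: card_UNIV_option)
  have "3 \<le> graph_diam ?G"
    unfolding graph_diam_def with_proj_simps verts_simplex_graph line_M_in_lines_at_distance_3(2)[OF assms S \<xi>, symmetric]
    by (intro SUP_upper2[OF line_L_in_simplex_lines] SUP_upper line_M_in_lines_at_distance_3(1)[OF assms S \<xi>])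
  moreover have "graph_diam ?G \<le> 3"
    unfolding graph_diam_def with_proj_simps verts_simplex_graph by (intro SUP_least simplex_dist_le_3)
  ultimately show "graph_diam ?G = 3" by (rule antisym[rotated])
qed

end
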